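(* Let $c>0$ and let $L\subset\mathbb{R}^3$ be a piecewise smooth curve (the source curve). Let $\tau$ be a bounded intensity function with $\tau(x)\geq\tau_0>0$ for a constant $\tau_0$, let $\lambda(t)=\delta(t)$ (the Dirac delta distribution) be the signal function, and let $u(x,t)$ be the (causal) solution to the wave equation $$c^{-2}\partial_{tt}u(x,t)-\triangle u(x,t)=\lambda(t)\tau(x)\delta_{L}(x),\qquad x\in\mathbb{R}^3,\ t\in\mathbb{R}.$$ Assume that $\Omega\subset\mathbb{R}^3$ is an open ball of radius $R$ with $L\subset\Omega$, with boundary sphere $\partial\Omega$, and that the sampling region $D\subset\Omega$ satisfies $L\subset D$ and $D\cap\partial\Omega=\varnothing$. For $z\in D$ define the indicator function $$I(z)=\int_{\mathbb{R}}\int_{\partial\Omega}u(x,t)\,\big(G(x,t;z)\ast\lambda(t)\big)\,{\rm d}s(x)\,{\rm d}t .$$ Then $$I(z)=+\infty\ \text{ for } z\in L,\qquad I(z)<+\infty\ \text{ for } z\in D\setminus L.$$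
   Context: For a curve $L$, $\delta_{L}(x)=\int_{L}\delta(x-y)\,{\rm d}s(y)$, with ${\rm d}s(y)$ arc length on $L$; the curve has finite length. The Green's function of the d'Alembert operator $c^{-2}\partial_{tt}-\triangle$ in $\mathbb{R}^3$ is $G(x,t;s)=\dfrac{\delta(t-c^{-1}|x-s|)}{4\pi|x-s|}$, and $G(x,t;s)\ast\lambda(t)=\dfrac{\lambda(t-c^{-1}|x-s|)}{4\pi|x-s|}$ denotes convolution in time. The signal is causal (the source vanishes for $t<0$), and the solution of the wave equation is $u(x,t)=\int_{L}\tau(y)\,G(x,t;y)\ast\lambda(t)\,{\rm d}s(y)$. Here ${\rm d}s(x)$ is surface measure on $\partial\Omega$. Conventions for the delta distributions, since $\lambda=\delta$: the time integral is performed by the rule $\int_{\mathbb{R}}\delta(t-\alpha)\delta(t-\beta)\,{\rm d}t=\delta(\alpha-\beta)$ and the integration over $L$ is taken outermost, so that $$I(z)=\int_{L}\tau(y)\int_{\partial\Omega}\frac{\delta\left(c^{-1}|x-y|-c^{-1}|x-z|\right)}{16\pi^2|x-y||x-z|}\,{\rm d}s(x)\,{\rm d}s(y).$$ For a continuous function $f$ and a smooth function $h$ on the sphere $\partial\Omega$ whose tangential gradient $\nabla_{\partial\Omega}h$ does not vanish on $\{h=0\}$, $\int_{\partial\Omega}f\,\delta(h)\,{\rm d}s=\int_{\{h=0\}}\frac{f}{|\nabla_{\partial\Omega}h|}\,{\rm d}\ell$, where ${\rm d}\ell$ is arc length on the curve $\{h=0\}$ (this defines the inner integral for all $y\neq z$).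 *)

theory Defs
  imports "HOL-Analysis.Analysis"
begin

type_synonym point = "real ^ 3"

section \<open>Curves and arc length\<close>

text \<open>Arc length of curves, taken as subsets of a metric space, is one-dimensional Hausdorff
  measure. The guard \<open>bounded\<close> is needed because \<^const>\<open>diameter\<close> is unspecified on unbounded
  sets.\<close>

definition hausdorff1_pre :: "real \<Rightarrow> 'a::metric_space set \<Rightarrow> ennreal" where
  "hausdorff1_pre \<epsilon> A =
     (INF U \<in> {U :: nat \<Rightarrow> 'a set. A \<subseteq> (\<Union>i. U i) \<and> (\<forall>i. bounded (U i) \<and> diameter (U i) \<le> \<epsilon>)}.
        \<Sum>i. ennreal (diameter (U i)))"

definition hausdorff1 :: "'a::metric_space set \<Rightarrow> ennreal" where
  "hausdorff1 A = (SUP \<epsilon> \<in> {0<..}. hausdorff1_pre \<epsilon> A)"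

text \<open>\<^const>\<open>hausdorff1\<close> is a metric outer measure, hence countably additive on the Borel sets, so
  that \<^const>\<open>measure_of\<close> yields a measure that agrees with it on every Borel set.\<close>

definition arclength :: "'a::metric_space measure" where
  "arclength = measure_of UNIV (sets borel) hausdorff1"

text \<open>Continuous, \<open>C\<^sup>1\<close> with nonvanishing tangent off finitely many parameters; self-intersections
  and closed curves are allowed.\<close>

definition piecewise_smooth_curve :: "'a::real_normed_vector set \<Rightarrow> bool" where
  "piecewise_smooth_curve L \<longleftrightarrow>
     (\<exists>\<gamma> S. valid_path \<gamma> \<and> path_image \<gamma> = L \<and> finite S \<and>
        (\<forall>t \<in> {0..1} - S. vector_derivative \<gamma> (at t) \<noteq> 0))"

section \<open>Deltas in time, the Green's function, and wave fields\<close>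

text \<open>\<open>Pulse w \<alpha>\<close> stands for the distribution \<open>w \<delta>(t - \<alpha>)\<close> in the time variable \<open>t\<close>.\<close>

datatype pulse = Pulse (weight: real) (arrival: real)

definition dirac_signal :: pulse where
  "dirac_signal = Pulse 1 0"

definition scale_pulse :: "real \<Rightarrow> pulse \<Rightarrow> pulse" where
  "scale_pulse r p = Pulse (r * weight p) (arrival p)"

text \<open>Convolution in time: \<open>(v \<delta>(t - \<alpha>)) \<ast> (w \<delta>(t - \<beta>)) = v w \<delta>(t - (\<alpha> + \<beta>))\<close>.\<close>

definition convolve :: "pulse \<Rightarrow> pulse \<Rightarrow> pulse" where
  "convolve p q = Pulse (weight p * weight q) (arrival p + arrival q)"

text \<open>\<open>green c x s\<close> is \<open>G(x, t; s) = \<delta>(t - |x - s| / c) / (4 \<pi> |x - s|)\<close> as a distribution in \<open>t\<close>.\<close>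

definition green :: "real \<Rightarrow> point \<Rightarrow> point \<Rightarrow> pulse" where
  "green c x s = Pulse (1 / (4 * pi * dist x s)) (dist x s / c)"

text \<open>A field \<open>u\<close> stands for the space-time distribution
  \<open>u(x, t) = \<integral>\<^sub>L w(x, y) \<delta>(t - \<alpha>(x, y)) ds(y)\<close> where \<open>u x y = Pulse (w(x, y)) (\<alpha>(x, y))\<close>.\<close>

type_synonym field = "point \<Rightarrow> point \<Rightarrow> pulse"

text \<open>The representation of the solution,
  \<open>u(x, t) = \<integral>\<^sub>L \<tau>(y) G(x, t; y) \<ast> \<lambda>(t) ds(y)\<close>.\<close>

definition retarded_field :: "real \<Rightarrow> (point \<Rightarrow> real) \<Rightarrow> pulse \<Rightarrow> field" where
  "retarded_field c \<tau> lam = (\<lambda>x y. scale_pulse (\<tau> y) (convolve (green c x y) lam))"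

section \<open>The wave equation in the sense of distributions\<close>

text \<open>\<open>C\<^sup>\<infinity>\<close>: differentiable, with all directional derivatives again \<open>C\<^sup>\<infinity>\<close>.\<close>

coinductive smooth :: "('a::real_normed_vector \<Rightarrow> real) \<Rightarrow> bool" where
  "(\<And>p. (\<phi> has_derivative \<phi>' p) (at p)) \<Longrightarrow> (\<And>v. smooth (\<lambda>p. \<phi>' p v)) \<Longrightarrow> smooth \<phi>"

definition test_function :: "('a::real_normed_vector \<Rightarrow> real) \<Rightarrow> bool" where
  "test_function \<phi> \<longleftrightarrow> smooth \<phi> \<and> compact (closure {p. \<phi> p \<noteq> 0})"

definition directional :: "'a::real_normed_vector \<Rightarrow> ('a \<Rightarrow> real) \<Rightarrow> 'a \<Rightarrow> real" where
  "directional v \<phi> = (\<lambda>p. frechet_derivative \<phi> (at p) v)"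

text \<open>\<open>c\<^sup>-\<^sup>2 \<partial>\<^sub>t\<^sub>t \<phi> - \<triangle>\<phi>\<close> for \<open>\<phi>\<close> a function of \<open>(x, t)\<close>.\<close>

definition dalembert :: "real \<Rightarrow> (point \<times> real \<Rightarrow> real) \<Rightarrow> point \<times> real \<Rightarrow> real" where
  "dalembert c \<phi> = (\<lambda>p. directional (0, 1) (directional (0, 1) \<phi>) p / c\<^sup>2
      - (\<Sum>b\<in>Basis. directional (b, 0) (directional (b, 0) \<phi>) p))"

definition field_pairing :: "point set \<Rightarrow> field \<Rightarrow> (point \<times> real \<Rightarrow> real) \<Rightarrow> real" where
  "field_pairing L u \<phi> =
     (LINT y:L|arclength. (LINT x|lborel. weight (u x y) * \<phi> (x, arrival (u x y))))"

text \<open>\<open>c\<^sup>-\<^sup>2 \<partial>\<^sub>t\<^sub>t u - \<triangle>u = \<lambda>(t) \<tau>(x) \<delta>\<^sub>L(x)\<close>, tested against \<open>\<phi>\<close>; the operator is formally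
  self-adjoint. \<open>u\<close> is causal if it vanishes on \<open>t < 0\<close>.\<close>

definition wave_equation :: "real \<Rightarrow> point set \<Rightarrow> (point \<Rightarrow> real) \<Rightarrow> pulse \<Rightarrow> field \<Rightarrow> bool" where
  "wave_equation c L \<tau> lam u \<longleftrightarrow>
     (\<forall>\<phi>. test_function \<phi> \<longrightarrow>
        field_pairing L u (dalembert c \<phi>) =
        (LINT y:L|arclength. \<tau> y * (weight lam * \<phi> (y, arrival lam))))"

definition causal :: "point set \<Rightarrow> field \<Rightarrow> bool" where
  "causal L u \<longleftrightarrow>
     (\<forall>\<phi>. test_function \<phi> \<and> (\<forall>x t. t \<ge> 0 \<longrightarrow> \<phi> (x, t) = 0) \<longrightarrow> field_pairing L u \<phi> = 0)"

section \<open>Surface integrals against a delta, and the indicator function\<close>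

definition gradient :: "('a::real_inner \<Rightarrow> real) \<Rightarrow> 'a \<Rightarrow> 'a" where
  "gradient h x = (THE D. GDERIV h x :> D)"

text \<open>Tangential gradient on spheres centred at \<open>a\<close>; the unit normal at \<open>x\<close> is \<open>sgn (x - a)\<close>.\<close>

definition tangential_gradient :: "'a::real_inner \<Rightarrow> ('a \<Rightarrow> real) \<Rightarrow> 'a \<Rightarrow> 'a" where
  "tangential_gradient a h x =
     gradient h x - (gradient h x \<bullet> sgn (x - a)) *\<^sub>R sgn (x - a)"

text \<open>\<open>\<integral> f \<delta>(h) ds\<close> over the sphere of centre \<open>a\<close> and radius \<open>R\<close>, for \<open>f \<ge> 0\<close> and \<open>h\<close> whose
  tangential gradient does not vanish on the zero set of \<open>h\<close> in the sphere.\<close>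

definition sphere_delta_integral ::
    "'a::real_inner \<Rightarrow> real \<Rightarrow> ('a \<Rightarrow> real) \<Rightarrow> ('a \<Rightarrow> real) \<Rightarrow> ennreal" where
  "sphere_delta_integral a R f h =
     (\<integral>\<^sup>+x \<in> {x \<in> sphere a R. h x = 0}. ennreal (f x / norm (tangential_gradient a h x)) \<partial>arclength)"

text \<open>\<open>I(z)\<close>, with the integral over \<open>L\<close> (hidden in \<open>u\<close>) taken outermost and the time integral of
  a product of two pulses evaluated by
  \<open>\<integral> v \<delta>(t - \<alpha>) w \<delta>(t - \<beta>) dt = v w \<delta>(\<alpha> - \<beta>)\<close>. If \<open>y = z\<close> the inner integral has no
  meaning; it is then \<open>0\<close> by the convention for division by zero, and the single point \<open>y = z\<close>
  has arc length zero.\<close>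

definition imaging_indicator ::
    "real \<Rightarrow> point \<Rightarrow> real \<Rightarrow> point set \<Rightarrow> pulse \<Rightarrow> field \<Rightarrow> point \<Rightarrow> ennreal" where
  "imaging_indicator c a R L lam u z =
     (\<integral>\<^sup>+y \<in> L.
        sphere_delta_integral a R
          (\<lambda>x. weight (u x y) * weight (convolve (green c x z) lam))
          (\<lambda>x. arrival (u x y) - arrival (convolve (green c x z) lam)) \<partial>arclength)"

end

(* For z and y in the ball, the zero set of |x - y| - |x - z| on the sphere is a circle of radius
   rho = sqrt (R^2 - s^2), where s is the distance from the centre to the bisecting plane. On it the
   tangential gradient of the travel time difference has norm |y - z| rho / (c R |x - y|), so rho
   cancels against the length of the circle and the inner integral is comparable to 1 / |y - z|.
   Off L this kernel is bounded. For z in L, connectedness gives each dyadic annulus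
   d / 2^(k+1) < |y - z| < d / 2^k at least d / 2^(k+1) of the arc length of L, so every annulus
   contributes a fixed positive amount and the integral diverges. *)
theory Submission
  imports Defs
begin

section \<open>Hausdorff measure as a metric outer measure\<close>

text \<open>The curve is given only as a set, so every length estimate has to come from
  \<open>hausdorff1\<close> itself. Since \<open>measure_of\<close> yields the zero measure when its
  set function is not countably additive on the generated sigma-algebra, Caratheodory's argument has
  to precede any computation with \<open>arclength\<close>.

  Lengths are then never computed, only compared: a 1-Lipschitz function whose values fill an
  interval bounds the length from below, and a Lipschitz parametrization bounds it from above.
  Divergence and finiteness depend on the kernel only up to constant factors, so the circumference 2
  pi \<rho> may be replaced by the cruder bounds 2 \<rho> and 4 pi \<rho>.

  The integrals over L and over the circle are compared with simple functions, where monotonicity of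
  the nonnegative integral is enough. The estimates of the kernel exclude y = z; for z in L the
  annuli around z avoid this point.\<close>

lemma hausdorff1_pre_le:
  assumes "A \<subseteq> (\<Union>i. U i)" "\<And>i::nat. bounded (U i)" "\<And>i. diameter (U i) \<le> \<epsilon>"
  shows "hausdorff1_pre \<epsilon> A \<le> (\<Sum>i. ennreal (diameter (U i)))"
  unfolding hausdorff1_pre_def using assms by (intro INF_lower) auto

lemma hausdorff1_pre_mono: "A \<subseteq> B \<Longrightarrow> hausdorff1_pre \<epsilon> A \<le> hausdorff1_pre \<epsilon> B"
  unfolding hausdorff1_pre_def by (rule INF_superset_mono) auto

lemma hausdorff1_pre_antimono: "\<delta> \<le> \<epsilon> \<Longrightarrow> hausdorff1_pre \<epsilon> A \<le> hausdorff1_pre \<delta> A"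
  unfolding hausdorff1_pre_def by (rule INF_superset_mono) (auto intro: order_trans)

lemma hausdorff1_pre_empty: "0 \<le> \<epsilon> \<Longrightarrow> hausdorff1_pre \<epsilon> {} = 0"
  using hausdorff1_pre_le[of "{}" "\<lambda>_. {}" \<epsilon>] by simp

text \<open>Once the right side is assumed finite, each \<open>A n\<close> has a cover whose sum
  exceeds the infimum by less than e/2^(n+1). The pairing function merges these covers into one
  sequence, and the errors add up to e.\<close>

lemma hausdorff1_pre_UN:
  fixes A :: "nat \<Rightarrow> 'a::metric_space set"
  shows "hausdorff1_pre \<epsilon> (\<Union>n. A n) \<le> (\<Sum>n. hausdorff1_pre \<epsilon> (A n))"
proof (rule ennreal_le_epsilon)
  fix e :: real
  assume fin: "(\<Sum>n. hausdorff1_pre \<epsilon> (A n)) < top" and "0 < e"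
  have "\<exists>U. A n \<subseteq> (\<Union>i::nat. U i) \<and> (\<forall>i. bounded (U i) \<and> diameter (U i) \<le> \<epsilon>) \<and>
      (\<Sum>i. ennreal (diameter (U i))) < hausdorff1_pre \<epsilon> (A n) + ennreal (e * (1/2) ^ Suc n)" for n
  proof -
    have "hausdorff1_pre \<epsilon> (A n) \<le> (\<Sum>n. hausdorff1_pre \<epsilon> (A n))"
      using sum_le_suminf[OF summableI, of "{n}"] by auto
    then have "hausdorff1_pre \<epsilon> (A n) \<noteq> \<infinity>" using fin by auto
    from INF_approx_ennreal[OF _ hausdorff1_pre_def this, of "e * (1/2) ^ Suc n"] \<open>0 < e\<close>
    show ?thesis by auto
  qed
  then obtain U where U: "\<And>n. A n \<subseteq> (\<Union>i::nat. U n i)"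
      "\<And>n i. bounded (U n i)" "\<And>n i. diameter (U n i) \<le> \<epsilon>"
      "\<And>n. (\<Sum>i. ennreal (diameter (U n i))) < hausdorff1_pre \<epsilon> (A n) + ennreal (e * (1/2) ^ Suc n)"
    by metis
  define V where "V = (\<lambda>k. case_prod U (prod_decode k))"
  have "(\<Union>n. A n) \<subseteq> (\<Union>k. V k)"
  proof
    fix x assume "x \<in> (\<Union>n. A n)"
    then obtain n i where "x \<in> U n i" using U(1) by blast
    then have "x \<in> V (prod_encode (n, i))" by (simp add: V_def)
    then show "x \<in> (\<Union>k. V k)" by blast
  qed
  moreover have "bounded (V k)" "diameter (V k) \<le> \<epsilon>" for k
    using U by (simp_all add: V_def split: prod.split)
  ultimately have "hausdorff1_pre \<epsilon> (\<Union>n. A n) \<le> (\<Sum>k. ennreal (diameter (V k)))"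
    by (rule hausdorff1_pre_le)
  also have "\<dots> = (\<Sum>k. (\<lambda>p. ennreal (diameter (case_prod U p))) (prod_decode k))"
    by (simp add: V_def)
  also have "\<dots> = (\<Sum>n. \<Sum>i. ennreal (diameter (U n i)))"
    by (rule suminf_ennreal_2dimen) simp
  also have "\<dots> \<le> (\<Sum>n. hausdorff1_pre \<epsilon> (A n) + ennreal e * ennreal ((1/2) ^ Suc n))"
    using U(4) \<open>0 < e\<close> by (intro suminf_le) (auto simp: less_imp_le simp flip: ennreal_mult')
  also have "\<dots> = (\<Sum>n. hausdorff1_pre \<epsilon> (A n)) + ennreal e * (\<Sum>n. ennreal ((1/2) ^ Suc n))"
    by (subst suminf_add[symmetric]) (auto simp del: power_Suc)
  also have "\<dots> = (\<Sum>n. hausdorff1_pre \<epsilon> (A n)) + ennreal e"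
    by (subst suminf_ennreal_eq[OF _ power_half_series]) auto
  finally show "hausdorff1_pre \<epsilon> (\<Union>n. A n) \<le> (\<Sum>n. hausdorff1_pre \<epsilon> (A n)) + ennreal e" .
qed

section \<open>The limit of vanishing scale is an outer measure\<close>

lemma hausdorff1_pre_le_hausdorff1: "0 < \<epsilon> \<Longrightarrow> hausdorff1_pre \<epsilon> A \<le> hausdorff1 A"
  unfolding hausdorff1_def by (rule SUP_upper) simp

lemma hausdorff1_mono: "A \<subseteq> B \<Longrightarrow> hausdorff1 A \<le> hausdorff1 B"
  unfolding hausdorff1_def by (intro SUP_mono') (simp add: hausdorff1_pre_mono)

lemma hausdorff1_empty [simp]: "hausdorff1 {} = 0"
  by (auto simp: hausdorff1_def hausdorff1_pre_empty intro!: SUP_eq_const)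

lemma hausdorff1_UN: "hausdorff1 (\<Union>n::nat. A n) \<le> (\<Sum>n. hausdorff1 (A n))"
  unfolding hausdorff1_def[of "\<Union>n. A n"]
proof (rule SUP_least)
  fix \<epsilon> :: real assume "\<epsilon> \<in> {0<..}"
  then have "(\<Sum>n. hausdorff1_pre \<epsilon> (A n)) \<le> (\<Sum>n. hausdorff1 (A n))"
    by (intro suminf_le) (auto intro: hausdorff1_pre_le_hausdorff1)
  then show "hausdorff1_pre \<epsilon> (\<Union>n. A n) \<le> (\<Sum>n. hausdorff1 (A n))"
    using hausdorff1_pre_UN order_trans by blast
qed

lemma hausdorff1_Un: "hausdorff1 (A \<union> B) \<le> hausdorff1 A + hausdorff1 B"
proof -
  define C where "C n = (if n = 0 then A else if n = 1 then B else {})" for n :: nat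
  have "(\<Union>n. C n) = A \<union> B"
    by (auto simp: C_def split: if_splits)
  moreover have "(\<Sum>n. hausdorff1 (C n)) = (\<Sum>n\<in>{0,1}. hausdorff1 (C n))"
    by (intro suminf_finite) (auto simp: C_def)
  ultimately show ?thesis
    using hausdorff1_UN[of C] by (simp add: C_def)
qed

section \<open>Additivity on separated sets and Caratheodory's criterion\<close>

lemma hausdorff1_pre_separated:
  assumes sep: "\<And>x y. x \<in> A \<Longrightarrow> y \<in> B \<Longrightarrow> \<epsilon> < dist x y" and "0 < \<epsilon>"
  shows "hausdorff1_pre \<epsilon> A + hausdorff1_pre \<epsilon> B \<le> hausdorff1_pre \<epsilon> (A \<union> B)"
  unfolding hausdorff1_pre_def[of \<epsilon> "A \<union> B"]
proof (rule INF_greatest, safe)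
  fix U :: "nat \<Rightarrow> 'a set"
  assume cov: "A \<union> B \<subseteq> (\<Union>i. U i)" and U: "\<forall>i. bounded (U i) \<and> diameter (U i) \<le> \<epsilon>"
  \<comment> \<open>Members that miss \<open>C\<close> become empty and so have diameter 0. Both
    covers keep the index set of \<open>U\<close>, and their sums can be added term by term.\<close>
  define V where "V C i = (if U i \<inter> C = {} then {} else U i)" for C i
  have V: "hausdorff1_pre \<epsilon> C \<le> (\<Sum>i. ennreal (diameter (V C i)))" if "C \<subseteq> A \<union> B" for C
    using that cov U \<open>0 < \<epsilon>\<close>
    by (intro hausdorff1_pre_le) (auto simp: V_def split: if_splits, blast)
  \<comment> \<open>A set of diameter at most \<epsilon> cannot meet two sets that are more than
    \<epsilon> apart.\<close>
  have one: "V A i = {} \<or> V B i = {}" for i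
  proof (rule ccontr)
    assume "\<not> ?thesis"
    then obtain x y where "x \<in> U i" "x \<in> A" "y \<in> U i" "y \<in> B"
      by (auto simp: V_def split: if_splits)
    then show False
      using sep[of x y] U diameter_bounded_bound[of "U i" x y] by (meson leD order_trans)
  qed
  have "hausdorff1_pre \<epsilon> A + hausdorff1_pre \<epsilon> B
      \<le> (\<Sum>i. ennreal (diameter (V A i))) + (\<Sum>i. ennreal (diameter (V B i)))"
    by (intro add_mono V) auto
  also have "\<dots> = (\<Sum>i. ennreal (diameter (V A i)) + ennreal (diameter (V B i)))"
    by (simp add: suminf_add)
  also have "\<dots> \<le> (\<Sum>i. ennreal (diameter (U i)))"
  proof (intro suminf_le allI summableI)
    show "ennreal (diameter (V A i)) + ennreal (diameter (V B i)) \<le> ennreal (diameter (U i))" for i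
      using one[of i] by (cases "U i \<inter> A = {}"; cases "U i \<inter> B = {}") (simp_all add: V_def)
  qed
  finally show "hausdorff1_pre \<epsilon> A + hausdorff1_pre \<epsilon> B \<le> (\<Sum>i. ennreal (diameter (U i)))" .
qed

text \<open>The pre-measures grow as the scale shrinks. This makes the sum of the two suprema a
  single supremum, and it allows every scale to be replaced by one below the gap \<delta>.\<close>

lemma hausdorff1_separated:
  assumes sep: "\<And>x y. x \<in> A \<Longrightarrow> y \<in> B \<Longrightarrow> \<delta> \<le> dist x y" and "0 < \<delta>"
  shows "hausdorff1 A + hausdorff1 B \<le> hausdorff1 (A \<union> B)"
proof -
  have "hausdorff1 A + hausdorff1 B = (SUP \<epsilon>\<in>{0<..}. hausdorff1_pre \<epsilon> A + hausdorff1_pre \<epsilon> B)"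
    unfolding hausdorff1_def
  proof (rule SUP_add_directed_ennreal[symmetric])
    fix i j :: real assume "i \<in> {0<..}" "j \<in> {0<..}"
    then show "\<exists>k\<in>{0<..}. hausdorff1_pre i A + hausdorff1_pre j B
        \<le> hausdorff1_pre k A + hausdorff1_pre k B"
      by (intro bexI[of _ "min i j"] add_mono hausdorff1_pre_antimono) auto
  qed
  also have "\<dots> \<le> hausdorff1 (A \<union> B)"
  proof (rule SUP_least)
    fix \<epsilon> :: real assume "\<epsilon> \<in> {0<..}"
    \<comment> \<open>Halving \<delta> keeps the scale strictly below the gap, as
      \<open>hausdorff1_pre_separated\<close> demands.\<close>
    define \<eta> where "\<eta> = min \<epsilon> (\<delta> / 2)"
    have \<eta>: "0 < \<eta>" "\<eta> \<le> \<epsilon>" "\<eta> < \<delta>" using \<open>\<epsilon> \<in> {0<..}\<close> \<open>0 < \<delta>\<close> by (auto simp: \<eta>_def)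
    have "hausdorff1_pre \<epsilon> A + hausdorff1_pre \<epsilon> B \<le> hausdorff1_pre \<eta> A + hausdorff1_pre \<eta> B"
      using \<eta> by (intro add_mono hausdorff1_pre_antimono)
    also have "\<dots> \<le> hausdorff1_pre \<eta> (A \<union> B)"
      using \<eta> sep by (intro hausdorff1_pre_separated) (auto intro: less_le_trans)
    also have "\<dots> \<le> hausdorff1 (A \<union> B)"
      using \<eta>(1) by (rule hausdorff1_pre_le_hausdorff1)
    finally show "hausdorff1_pre \<epsilon> A + hausdorff1_pre \<epsilon> B \<le> hausdorff1 (A \<union> B)" .
  qed
  finally show ?thesis .
qed

text \<open>The gap may shrink with \<open>k\<close>: the induction attaches one set at a time to
  finitely many earlier ones and asks for a positive gap only at that step.\<close>

lemma hausdorff1_sum_separated: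
  assumes "\<And>k. \<exists>\<delta>>0. \<forall>j<k. \<forall>x\<in>S j. \<forall>y\<in>S k. \<delta> \<le> dist x y"
  shows "(\<Sum>j<n::nat. hausdorff1 (S j)) \<le> hausdorff1 (\<Union>j<n. S j)"
proof (induction n)
  case (Suc n)
  obtain \<delta> where "\<delta> > 0" "\<And>j x y. j < n \<Longrightarrow> x \<in> S j \<Longrightarrow> y \<in> S n \<Longrightarrow> \<delta> \<le> dist x y"
    using assms[of n] by auto
  then have "hausdorff1 (\<Union>j<n. S j) + hausdorff1 (S n) \<le> hausdorff1 ((\<Union>j<n. S j) \<union> S n)"
    by (intro hausdorff1_separated) auto
  also have "(\<Union>j<n. S j) \<union> S n = (\<Union>j<Suc n. S j)"
    by (auto simp: less_Suc_eq)
  finally have "hausdorff1 (\<Union>j<n. S j) + hausdorff1 (S n) \<le> hausdorff1 (\<Union>j<Suc n. S j)" .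
  with add_right_mono[OF Suc, of "hausdorff1 (S n)"] show ?case
    unfolding sum.lessThan_Suc by (rule order_trans)
qed simp

text \<open>Adjacent shells touch, but the shells of even index are pairwise separated, and so are those
  of odd index; this gives the factor 2.\<close>

lemma hausdorff1_infdist_shells:
  fixes A C :: "'a::metric_space set"
  defines "S \<equiv> \<lambda>k::nat. {x \<in> A. 1 / (real k + 2) < infdist x C \<and> infdist x C \<le> 1 / (real k + 1)}"
  shows "(\<Sum>k. hausdorff1 (S k)) \<le> 2 * hausdorff1 A"
proof (rule suminf_le_const[OF summableI])
  have sep: "\<exists>\<delta>>0. \<forall>j<k. \<forall>x\<in>S (2 * j + p). \<forall>y\<in>S (2 * k + p). \<delta> \<le> dist x y" for k p
  proof (cases "k = 0")
    case True
    then show ?thesis by (auto intro: exI[of _ 1])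
  next
    case False
    \<comment> \<open>This is the width of the skipped shell, of index \<open>2 * k + p - 1\<close>,
      which lies between the two that are compared. As \<open>infdist\<close> is 1-Lipschitz, points
      on either side of it are at least this far apart.\<close>
    define \<delta> where "\<delta> = 1 / (2 * real k + real p) - 1 / (2 * real k + real p + 1)"
    have "0 < \<delta>" using False unfolding \<delta>_def diff_gt_0_iff_gt by (intro divide_strict_left_mono) auto
    moreover have "\<delta> \<le> dist x y" if "j < k" "x \<in> S (2 * j + p)" "y \<in> S (2 * k + p)" for j x y
    proof -
      have "1 / (2 * real k + real p) \<le> 1 / (2 * real j + real p + 2)"
        using \<open>j < k\<close> by (intro divide_left_mono) auto
      moreover have "1 / (2 * real j + real p + 2) < infdist x C"
          "infdist y C \<le> 1 / (2 * real k + real p + 1)"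
        using that by (auto simp: S_def)
      ultimately show ?thesis
        using infdist_triangle[of x C y] by (simp add: \<delta>_def)
    qed
    ultimately show ?thesis by blast
  qed
  have half: "(\<Sum>j<n. hausdorff1 (S (2 * j + p))) \<le> hausdorff1 A" for n p
  proof -
    have "(\<Sum>j<n. hausdorff1 (S (2 * j + p))) \<le> hausdorff1 (\<Union>j<n. S (2 * j + p))"
      by (rule hausdorff1_sum_separated) (rule sep)
    also have "\<dots> \<le> hausdorff1 A"
      by (rule hausdorff1_mono) (auto simp: S_def)
    finally show ?thesis .
  qed
  fix n
  have "(\<Sum>k<n. hausdorff1 (S k)) \<le> (\<Sum>k<2 * n. hausdorff1 (S k))"
    by (intro sum_mono2) auto
  also have "\<dots> = (\<Sum>j<n. hausdorff1 (S (2 * j + 0))) + (\<Sum>j<n. hausdorff1 (S (2 * j + 1)))"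
    by (induction n) (simp_all add: algebra_simps)
  also have "\<dots> \<le> 2 * hausdorff1 A"
    by (subst mult_2[of "hausdorff1 A"]) (intro add_mono half)
  finally show "(\<Sum>k<n. hausdorff1 (S k)) \<le> 2 * hausdorff1 A" .
qed

text \<open>The points of \<open>A - C\<close> at distance more than 1/(n+1) from \<open>C\<close>
  are separated from \<open>C \<inter> A\<close>, so additivity holds for them. The remaining points
  lie in the tail of a convergent series of shells and cost arbitrarily little.\<close>

lemma hausdorff1_split_closed:
  assumes "closed C"
  shows "hausdorff1 (C \<inter> A) + hausdorff1 (A - C) \<le> hausdorff1 A"
\<comment> \<open>The empty set is set apart because \<open>infdist x {}\<close> is 0 by convention
  and would not measure separation.\<close>
proof (cases "hausdorff1 A = top \<or> C = {}")
  case False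
  then have fin: "hausdorff1 A \<noteq> top" and "C \<noteq> {}" by auto
  define S where "S = (\<lambda>k::nat. {x \<in> A. 1 / (real k + 2) < infdist x C \<and> infdist x C \<le> 1 / (real k + 1)})"
  \<comment> \<open>Finite values turn the shell series into a summable real series with small
    tails.\<close>
  define s where "s k = enn2real (hausdorff1 (S k))" for k
  have "hausdorff1 (S k) \<noteq> top" for k
    using hausdorff1_mono[of "S k" A] fin by (auto simp: S_def top_unique)
  then have s: "hausdorff1 (S k) = ennreal (s k)" "0 \<le> s k" for k
    by (auto simp: s_def top.not_eq_extremum)
  have "(\<Sum>k. ennreal (s k)) \<le> 2 * hausdorff1 A"
    using hausdorff1_infdist_shells[of A C] by (simp add: S_def flip: s)
  then have "(\<Sum>k. ennreal (s k)) \<noteq> top"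
    using fin by (auto simp: top_unique ennreal_mult_eq_top_iff)
  then have summ: "summable s"
    using s(2) by (intro summable_suminf_not_top) auto
  show ?thesis
  proof (rule ennreal_le_epsilon)
    fix e :: real assume "0 < e"
    obtain n where n: "norm (\<Sum>k. s (k + n)) < e"
      using suminf_exist_split[OF \<open>0 < e\<close> summ] by blast
    define B where "B = {x \<in> A. 1 / (real n + 1) < infdist x C}"
    have "A - C \<subseteq> B \<union> (\<Union>k. S (k + n))"
    proof
      fix x assume x: "x \<in> A - C"
      then have pos: "0 < infdist x C"
        using infdist_pos_not_in_closed[OF \<open>closed C\<close> \<open>C \<noteq> {}\<close>] by blast
      show "x \<in> B \<union> (\<Union>k. S (k + n))"
      proof (cases "1 / (real n + 1) < infdist x C")
        case False
        \<comment> \<open>The first threshold below the distance of \<open>x\<close>. It comes after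
          \<open>n\<close>, and its predecessor \<open>k + n\<close> is the index of the shell that
          contains \<open>x\<close>.\<close>
        define m where "m = (LEAST m. 1 / (real m + 1) < infdist x C)"
        have "\<exists>m. 1 / (real m + 1) < infdist x C"
          using reals_Archimedean[OF pos] by (auto simp: inverse_eq_divide add.commute)
        then have m: "1 / (real m + 1) < infdist x C"
          unfolding m_def by (rule LeastI_ex)
        have "n < m"
        proof (rule ccontr)
          assume "\<not> n < m"
          then have "1 / (real n + 1) \<le> 1 / (real m + 1)" by (intro divide_left_mono) auto
          with m False show False by simp
        qed
        then obtain k where k: "m = Suc (k + n)" using less_iff_Suc_add by (auto simp: add.commute)
        have "\<not> 1 / (real (k + n) + 1) < infdist x C"
          using not_less_Least[of "k + n" "\<lambda>m. 1 / (real m + 1) < infdist x C"] k by (simp add: m_def)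
        then have "x \<in> S (k + n)"
          using m k x by (simp add: S_def add.commute)
        then show ?thesis by blast
      qed (use x in \<open>auto simp: B_def\<close>)
    qed
    then have "hausdorff1 (A - C) \<le> hausdorff1 (B \<union> (\<Union>k. S (k + n)))"
      by (rule hausdorff1_mono)
    also have "\<dots> \<le> hausdorff1 B + (\<Sum>k. hausdorff1 (S (k + n)))"
      by (rule order_trans[OF hausdorff1_Un add_left_mono[OF hausdorff1_UN]])
    also have "(\<Sum>k. hausdorff1 (S (k + n))) = ennreal (\<Sum>k. s (k + n))"
      unfolding s(1) using s(2) summ by (intro suminf_ennreal2) (auto simp: summable_iff_shift)
    also have "\<dots> \<le> ennreal e"
      using n by (intro ennreal_leI) auto
    finally have "hausdorff1 (A - C) \<le> hausdorff1 B + ennreal e"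
      by (simp add: add_left_mono)
    then have "hausdorff1 (C \<inter> A) + hausdorff1 (A - C) \<le> hausdorff1 (C \<inter> A) + (hausdorff1 B + ennreal e)"
      by (rule add_left_mono)
    also have "\<dots> = (hausdorff1 (C \<inter> A) + hausdorff1 B) + ennreal e"
      by (simp add: add.assoc)
    also have "hausdorff1 (C \<inter> A) + hausdorff1 B \<le> hausdorff1 (C \<inter> A \<union> B)"
    proof (rule hausdorff1_separated)
      fix x y assume "x \<in> C \<inter> A" "y \<in> B"
      then show "1 / (real n + 1) \<le> dist x y"
        using infdist_le[of x C y] by (auto simp: B_def dist_commute)
    qed simp
    also have "\<dots> \<le> hausdorff1 A"
      by (rule hausdorff1_mono) (auto simp: B_def)
    finally show "hausdorff1 (C \<inter> A) + hausdorff1 (A - C) \<le> hausdorff1 A + ennreal e"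
      by (simp add: add_right_mono)
  qed
qed auto

text \<open>Closed sets lie in the Caratheodory sigma-algebra of the outer measure by
  \<open>hausdorff1_split_closed\<close>, and they generate the Borel sets.\<close>

lemma measure_space_hausdorff1:
  "measure_space UNIV (sets borel) (hausdorff1 :: 'a::metric_space set \<Rightarrow> ennreal)"
proof -
  interpret sigma_algebra UNIV "UNIV :: 'a set set"
    using sigma_algebra_Pow[of "UNIV :: 'a set"] by simp
  let ?L = "lambda_system UNIV UNIV (hausdorff1 :: 'a set \<Rightarrow> ennreal)"
  have "outer_measure_space UNIV (hausdorff1 :: 'a set \<Rightarrow> ennreal)"
    by (auto simp: outer_measure_space_def positive_def increasing_def countably_subadditive_def
        intro: hausdorff1_mono hausdorff1_UN)
  then have L: "measure_space UNIV ?L hausdorff1"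
    by (rule caratheodory_lemma)
  then interpret L: sigma_algebra UNIV ?L
    by (simp add: measure_space_def)
  have closed: "C \<in> ?L" if "closed C" for C :: "'a set"
  proof -
    have "hausdorff1 (A \<inter> C) + hausdorff1 (A - C) = hausdorff1 A" for A
    proof (rule antisym)
      show "hausdorff1 (A \<inter> C) + hausdorff1 (A - C) \<le> hausdorff1 A"
        using hausdorff1_split_closed[OF that, of A] by (simp add: Int_commute)
      have "A = (A \<inter> C) \<union> (A - C)" by blast
      then show "hausdorff1 A \<le> hausdorff1 (A \<inter> C) + hausdorff1 (A - C)"
        using hausdorff1_Un[of "A \<inter> C" "A - C"] by simp
    qed
    then show ?thesis by (simp add: lambda_system_eq)
  qed
  have "open U \<Longrightarrow> U \<in> ?L" for U :: "'a set"
    using L.compl_sets[OF closed[of "- U"]] by (simp add: closed_Compl Diff_eq)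
  then have "sets borel \<subseteq> ?L"
    unfolding sets_borel by (intro L.sigma_sets_subset) auto
  then have "countably_additive (sets borel) (hausdorff1 :: 'a set \<Rightarrow> ennreal)"
    using L unfolding measure_space_def countably_additive_def by blast
  then show ?thesis
    using sets.sigma_algebra_axioms[of "borel :: 'a measure"]
    by (simp add: measure_space_def positive_def)
qed

section \<open>Arc length as a Borel measure\<close>

lemma sets_arclength [simp, measurable_cong]: "sets arclength = sets borel"
  by (simp add: arclength_def sets_measure_of_conv sets.sigma_sets_eq[of borel, simplified])

lemma space_arclength [simp]: "space arclength = UNIV"
  by (simp add: arclength_def space_measure_of_conv)

lemma emeasure_arclength: "A \<in> sets borel \<Longrightarrow> emeasure arclength A = hausdorff1 A"
  unfolding arclength_def using measure_space_hausdorff1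
  by (intro emeasure_measure_of_sigma) (auto simp: measure_space_def)

section \<open>Lipschitz images and connected sets\<close>

text \<open>A 1-Lipschitz map does not increase diameters, and a set of reals of diameter r lies in
  an interval of length r. A cover of \<open>A\<close> therefore gives a cover of the interval, to
  which subadditivity of Lebesgue measure applies.\<close>

lemma hausdorff1_ge_interval:
  fixes f :: "'a::metric_space \<Rightarrow> real"
  assumes lip: "1-lipschitz_on A f" and sub: "{p<..<q} \<subseteq> f ` A"
  shows "ennreal (q - p) \<le> hausdorff1 A"
proof (cases "p \<le> q")
  case True
  \<comment> \<open>The bound holds at every scale; 1 is an arbitrary choice.\<close>
  have "ennreal (q - p) \<le> hausdorff1_pre 1 A"
    unfolding hausdorff1_pre_def
  proof (rule INF_greatest, safe)
    fix U :: "nat \<Rightarrow> 'a set"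
    assume cov: "A \<subseteq> (\<Union>i. U i)" and U: "\<forall>i. bounded (U i) \<and> diameter (U i) \<le> 1"
    \<comment> \<open>The image of an arbitrary \<open>U i\<close> need not be measurable, so it is
      enclosed in the interval from its infimum to its supremum.\<close>
    have "\<exists>J\<in>sets lborel. f ` (U i \<inter> A) \<subseteq> J \<and> emeasure lborel J \<le> ennreal (diameter (U i))" for i
    proof (cases "U i \<inter> A = {}")
      case True
      then show ?thesis by (intro bexI[of _ "{}"]) auto
    next
      case False
      let ?B = "f ` (U i \<inter> A)"
      have d: "f x \<le> f y + diameter (U i)" if "x \<in> U i \<inter> A" "y \<in> U i \<inter> A" for x y
        using lipschitz_onD[OF lip, of x y] diameter_bounded_bound[of "U i" x y] that U
        by (auto simp: dist_real_def)
      obtain x\<^sub>0 where x\<^sub>0: "x\<^sub>0 \<in> U i \<inter> A" using False by blast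
      have "bdd_above ?B" by (rule bdd_aboveI2) (rule d[OF _ x\<^sub>0])
      moreover have "bdd_below ?B"
        using d[OF x\<^sub>0] by (intro bdd_belowI2[of _ "f x\<^sub>0 - diameter (U i)"]) (simp add: algebra_simps)
      ultimately have "?B \<subseteq> {Inf ?B..Sup ?B}"
        by (auto intro: cSUP_upper cINF_lower)
      moreover have "Sup ?B - diameter (U i) \<le> Inf ?B"
      proof (rule cINF_greatest[OF False])
        fix y assume y: "y \<in> U i \<inter> A"
        have "Sup ?B \<le> f y + diameter (U i)"
          by (rule cSUP_least[OF False]) (rule d[OF _ y])
        then show "Sup ?B - diameter (U i) \<le> f y" by simp
      qed
      ultimately show ?thesis
        using x\<^sub>0 by (intro bexI[of _ "{Inf ?B..Sup ?B}"])
          (auto simp: emeasure_lborel_Icc_eq intro!: ennreal_leI)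
    qed
    then obtain J where J: "\<And>i. J i \<in> sets lborel" "\<And>i. f ` (U i \<inter> A) \<subseteq> J i"
        "\<And>i. emeasure lborel (J i) \<le> ennreal (diameter (U i))"
      by metis
    have "ennreal (q - p) = emeasure lborel {p<..<q}"
      using True by simp
    also have "\<dots> \<le> emeasure lborel (\<Union>i. J i)"
    proof (rule emeasure_mono)
      show "{p<..<q} \<subseteq> (\<Union>i. J i)"
        using sub cov J(2) by (fastforce simp: subset_iff image_iff)
      show "(\<Union>i. J i) \<in> sets lborel" using J(1) by blast
    qed
    also have "\<dots> \<le> (\<Sum>i. emeasure lborel (J i))"
      using J(1) by (intro emeasure_subadditive_countably) auto
    also have "\<dots> \<le> (\<Sum>i. ennreal (diameter (U i)))"
      using J(3) by (intro suminf_le) auto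
    finally show "ennreal (q - p) \<le> (\<Sum>i. ennreal (diameter (U i)))" .
  qed
  also have "\<dots> \<le> hausdorff1 A"
    by (rule hausdorff1_pre_le_hausdorff1) simp
  finally show ?thesis .
qed (simp add: ennreal_neg)

text \<open>Cutting the parameter interval into n equal pieces of length h gives n images of
  diameter at most K h. Their total is K (b - a) for every n, and a large n meets the scale
  \<epsilon>.\<close>

lemma hausdorff1_lipschitz_image_le:
  fixes f :: "real \<Rightarrow> 'a::metric_space"
  assumes lip: "K-lipschitz_on {a..b} f" and "a \<le> b" and "A \<subseteq> f ` {a..b}"
  shows "hausdorff1 A \<le> ennreal (K * (b - a))"
  unfolding hausdorff1_def
proof (rule SUP_least)
  fix \<epsilon> :: real assume "\<epsilon> \<in> {0<..}"
  have "0 \<le> K" using lip by (rule lipschitz_on_nonneg)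
  obtain n where n: "K * (b - a) / \<epsilon> < real n" using reals_Archimedean2 by blast
  moreover have "0 \<le> K * (b - a) / \<epsilon>" using \<open>0 \<le> K\<close> \<open>a \<le> b\<close> \<open>\<epsilon> \<in> {0<..}\<close> by simp
  ultimately have "0 < real n" by linarith
  then have "0 < n" by simp
  have "K * (b - a) \<le> \<epsilon> * real n"
    using n \<open>\<epsilon> \<in> {0<..}\<close> by (simp add: field_simps)
  define h where "h = (b - a) / n"
  have h: "0 \<le> h" "real n * h = b - a" "K * h \<le> \<epsilon>"
    using \<open>0 < n\<close> \<open>a \<le> b\<close> \<open>K * (b - a) \<le> \<epsilon> * real n\<close> by (auto simp: h_def field_simps)
  define U where "U i = (if i < n then f ` ({a..b} \<inter> {a + real i * h..a + real (Suc i) * h}) else {})" for i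
  have dist_U: "dist x y \<le> K * h" if xy: "x \<in> U i" "y \<in> U i" for x y i
  proof -
    define I where "I = {a..b} \<inter> {a + real i * h..a + real (Suc i) * h}"
    have "U i \<subseteq> f ` I" by (simp add: U_def I_def)
    then obtain s t where st: "x = f s" "y = f t" "s \<in> I" "t \<in> I"
      using xy by blast
    then have "s \<in> {a..b}" "t \<in> {a..b}" by (simp_all add: I_def)
    from st have "\<bar>s - t\<bar> \<le> h" by (auto simp: I_def abs_le_iff algebra_simps)
    have "dist x y \<le> K * dist s t"
      using st(1,2) \<open>s \<in> {a..b}\<close> \<open>t \<in> {a..b}\<close> lipschitz_onD[OF lip] by simp
    also have "\<dots> \<le> K * h"
      using \<open>\<bar>s - t\<bar> \<le> h\<close> \<open>0 \<le> K\<close> by (intro mult_left_mono) (auto simp: dist_real_def)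
    finally show ?thesis .
  qed
  have diam_U: "diameter (U i) \<le> (if i < n then K * h else 0)" for i
    using dist_U[of _ i] \<open>0 \<le> K\<close> h by (auto simp: diameter_def U_def intro!: cSUP_least)
  have "hausdorff1_pre \<epsilon> A \<le> (\<Sum>i. ennreal (diameter (U i)))"
  proof (rule hausdorff1_pre_le)
    show "bounded (U i)" for i using dist_U by (auto simp: bounded_two_points)
    show "diameter (U i) \<le> \<epsilon>" for i
      using diam_U[of i] h \<open>\<epsilon> \<in> {0<..}\<close> by (auto split: if_splits)
    show "A \<subseteq> (\<Union>i. U i)"
    proof
      fix x assume "x \<in> A"
      then obtain t where t: "x = f t" "t \<in> {a..b}" using \<open>A \<subseteq> f ` {a..b}\<close> by blast
      \<comment> \<open>The least piece whose right end is not passed contains \<open>t\<close>: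
        minimality gives the left end, and for index 0 this is \<open>a \<le> t\<close>.\<close>
      let ?P = "\<lambda>i. t \<le> a + real (Suc i) * h"
      define i where "i = (LEAST i. ?P i)"
      have P: "?P (n - 1)" using t h \<open>0 < n\<close> by simp
      then have "?P i" "i \<le> n - 1"
        unfolding i_def by (rule LeastI, rule Least_le)
      moreover have "a + real i * h \<le> t"
      proof (cases i)
        case (Suc j)
        then have "\<not> ?P j" using not_less_Least[of j ?P] by (simp add: i_def)
        then show ?thesis using Suc by simp
      qed (use t in auto)
      ultimately have "x \<in> U i" using t \<open>0 < n\<close> by (auto simp: U_def)
      then show "x \<in> (\<Union>i. U i)" by blast
    qed
  qed
  also have "\<dots> = (\<Sum>i<n. ennreal (diameter (U i)))"
    by (intro suminf_finite) (auto simp: U_def)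
  also have "\<dots> \<le> (\<Sum>i<n. ennreal (K * h))"
  proof (intro sum_mono ennreal_leI)
    show "diameter (U i) \<le> K * h" if "i \<in> {..<n}" for i
      using diam_U[of i] that by simp
  qed
  also have "\<dots> = ennreal (K * (b - a))"
    using h(1) \<open>0 \<le> K\<close> by (simp add: ennreal_of_nat_eq_real_of_nat mult_ac flip: ennreal_mult h(2))
  finally show "hausdorff1_pre \<epsilon> A \<le> ennreal (K * (b - a))" .
qed

text \<open>The distance to \<open>z\<close> is 1-Lipschitz. On the connected set \<open>L\<close>
  it takes all values between 0, reached at \<open>z\<close>, and \<open>dist w z\<close>, so its
  values on the annulus fill the open interval from p to q.\<close>

lemma hausdorff1_connected_annulus:
  assumes "connected L" "z \<in> L" "w \<in> L" "0 \<le> p" "q \<le> dist w z"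
  shows "ennreal (q - p) \<le> hausdorff1 {y \<in> L. p < dist y z \<and> dist y z < q}"
proof (rule hausdorff1_ge_interval)
  show "1-lipschitz_on {y \<in> L. p < dist y z \<and> dist y z < q} (\<lambda>y. dist y z)"
  proof (rule lipschitz_onI)
    show "dist (dist x z) (dist y z) \<le> 1 * dist x y" for x y
      using abs_dist_diff_le[of x z y] by (simp add: dist_real_def dist_commute)
  qed simp
  have "connected ((\<lambda>y. dist y z) ` L)"
    by (intro connected_continuous_image \<open>connected L\<close> continuous_intros)
  then have "{0..dist w z} \<subseteq> (\<lambda>y. dist y z) ` L"
    by (rule connected_contains_Icc) (use assms in \<open>auto intro: image_eqI[of _ _ z]\<close>)
  moreover have "{p<..<q} \<subseteq> {0..dist w z}"
    using \<open>0 \<le> p\<close> \<open>q \<le> dist w z\<close> by auto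
  ultimately have "{p<..<q} \<subseteq> (\<lambda>y. dist y z) ` L" by blast
  then show "{p<..<q} \<subseteq> (\<lambda>y. dist y z) ` {y \<in> L. p < dist y z \<and> dist y z < q}"
    by auto
qed

lemma nn_integral_inverse_dist_connected:
  assumes "connected L" "closed L" "z \<in> L" "w \<in> L" "w \<noteq> z" "0 < C"
    and ge: "\<And>y. y \<in> L \<Longrightarrow> y \<noteq> z \<Longrightarrow> ennreal (C / dist y z) \<le> g y"
  shows "(\<integral>\<^sup>+y\<in>L. g y \<partial>arclength) = \<infinity>"
proof (rule ccontr)
  define d where "d = dist w z"
  have "0 < d" using \<open>w \<noteq> z\<close> by (simp add: d_def)
  define A where "A k = {y \<in> L. d / 2 ^ Suc k < dist y z \<and> dist y z < d / 2 ^ k}" for k :: nat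
  have [measurable]: "A k \<in> sets borel" for k
  proof -
    have "A k = L \<inter> {y. d / 2 ^ Suc k < dist y z} \<inter> {y. dist y z < d / 2 ^ k}"
      by (auto simp: A_def)
    moreover have "open {y. d / 2 ^ Suc k < dist y z}" "open {y. dist y z < d / 2 ^ k}"
      by (intro open_Collect_less continuous_intros)+
    ultimately show ?thesis
      using \<open>closed L\<close> by (simp add: borel_closed borel_open sets.Int del: power_Suc)
  qed
  \<comment> \<open>The annuli are disjoint, so at each point at most one term of the step function
    below \<open>g\<close> is nonzero.\<close>
  have A_unique: "k = j" if "y \<in> A k" "y \<in> A j" for y j k
  proof -
    have "\<not> j < k" if "y \<in> A k" "y \<in> A j" for j k
    proof
      assume "j < k"
      then have "d / 2 ^ k \<le> d / 2 ^ Suc j"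
        using \<open>0 < d\<close> by (intro divide_left_mono power_increasing) auto
      with that show False by (auto simp: A_def)
    qed
    then show ?thesis using that by (meson linorder_neqE_nat)
  qed
  \<comment> \<open>This is C / (d / 2^k), a lower bound of C / \<open>dist y z\<close> on the
    annulus \<open>A k\<close>.\<close>
  define c where "c k = ennreal (C * 2 ^ k / d)" for k :: nat
  have le: "(\<Sum>k<n. c k * indicator (A k) y) \<le> g y * indicator L y" for n y
  proof (cases "\<exists>j<n. y \<in> A j")
    case True
    then obtain j where j: "j < n" "y \<in> A j" by blast
    have "0 < d / 2 ^ Suc j" using \<open>0 < d\<close> by simp
    with j(2) have y: "y \<in> L" "0 < dist y z" "dist y z \<le> d / 2 ^ j" by (auto simp: A_def)
    have "(\<Sum>k<n. c k * indicator (A k) y) = (\<Sum>k<n. if k = j then c j else 0)"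
      using j A_unique by (intro sum.cong) (auto simp: indicator_def)
    also have "\<dots> = c j" using j by simp
    also have "\<dots> \<le> ennreal (C / dist y z)"
      unfolding c_def
    proof (rule ennreal_leI)
      have "C / (d / 2 ^ j) \<le> C / dist y z"
        using \<open>0 < C\<close> \<open>0 < d\<close> y by (intro divide_left_mono mult_pos_pos) auto
      then show "C * 2 ^ j / d \<le> C / dist y z" by simp
    qed
    also have "\<dots> \<le> g y"
      using y by (intro ge) auto
    finally show ?thesis using y(1) by simp
  next
    case False
    then have "(\<Sum>k<n. c k * indicator (A k) y) = 0"
      by (intro sum.neutral) auto
    then show ?thesis by simp
  qed
  \<comment> \<open>The value \<open>c k\<close> times the length bound d / 2^(k+1) is C / 2 for
    every \<open>k\<close>, so n annuli contribute at least n C / 2.\<close>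
  have lower: "ennreal (real n * (C / 2)) \<le> (\<integral>\<^sup>+y\<in>L. g y \<partial>arclength)" for n
  proof -
    have "ennreal (real n * (C / 2)) = (\<Sum>k<n. ennreal (C / 2))"
      using \<open>0 < C\<close> by (simp add: ennreal_of_nat_eq_real_of_nat flip: ennreal_mult)
    also have "\<dots> \<le> (\<Sum>k<n. c k * emeasure arclength (A k))"
    proof (rule sum_mono)
      fix k
      have "C / 2 = C * 2 ^ k / d * (d / 2 ^ k - d / 2 ^ Suc k)"
        using \<open>0 < d\<close> by (simp add: right_diff_distrib)
      also have "ennreal \<dots> = c k * ennreal (d / 2 ^ k - d / 2 ^ Suc k)"
        unfolding c_def using \<open>0 < C\<close> \<open>0 < d\<close> by (intro ennreal_mult') auto
      finally have "ennreal (C / 2) = c k * ennreal (d / 2 ^ k - d / 2 ^ Suc k)" .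
      have "d / 2 ^ k \<le> d / 1"
        using \<open>0 < d\<close> by (intro divide_left_mono) auto
      then have "ennreal (d / 2 ^ k - d / 2 ^ Suc k) \<le> hausdorff1 (A k)"
        unfolding A_def using \<open>0 < d\<close> assms(1,3,4)
        by (intro hausdorff1_connected_annulus[where w=w]) (auto simp: d_def)
      then have "c k * ennreal (d / 2 ^ k - d / 2 ^ Suc k) \<le> c k * emeasure arclength (A k)"
        by (simp only: emeasure_arclength \<open>A k \<in> sets borel\<close> mult_left_mono zero_le)
      with \<open>ennreal (C / 2) = _\<close> show "ennreal (C / 2) \<le> c k * emeasure arclength (A k)"
        by simp
    qed
    also have "\<dots> = (\<integral>\<^sup>+y. (\<Sum>k<n. c k * indicator (A k) y) \<partial>arclength)"
      by (subst nn_integral_sum) (auto simp: nn_integral_cmult_indicator)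
    also have "\<dots> \<le> (\<integral>\<^sup>+y\<in>L. g y \<partial>arclength)"
      by (rule nn_integral_mono) (rule le)
    finally show ?thesis .
  qed
  assume "(\<integral>\<^sup>+y\<in>L. g y \<partial>arclength) \<noteq> \<infinity>"
  then obtain r where r: "0 \<le> r" "(\<integral>\<^sup>+y\<in>L. g y \<partial>arclength) = ennreal r"
    by (cases "\<integral>\<^sup>+y\<in>L. g y \<partial>arclength") auto
  obtain n where "r / (C / 2) < real n" using reals_Archimedean2 by blast
  then show False
    using lower[of n] r \<open>0 < C\<close> by (simp add: field_simps)
qed

section \<open>Topology of piecewise smooth curves\<close>

lemma piecewise_smooth_curve_compact: "piecewise_smooth_curve L \<Longrightarrow> compact L"
  by (auto simp: piecewise_smooth_curve_def intro: compact_path_image valid_path_imp_path)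

lemma piecewise_smooth_curve_connected: "piecewise_smooth_curve L \<Longrightarrow> connected L"
  by (auto simp: piecewise_smooth_curve_def intro: connected_path_image valid_path_imp_path)

text \<open>A constant path has derivative 0 at every interior parameter, and some interior
  parameter lies outside the finite exceptional set. The point \<open>w\<close> provides the outer
  radius of the annuli around \<open>z\<close>.\<close>

lemma piecewise_smooth_curve_not_singleton:
  assumes "piecewise_smooth_curve L"
  shows "\<exists>w\<in>L. w \<noteq> z"
proof (rule ccontr)
  assume const: "\<not> ?thesis"
  obtain \<gamma> S where \<gamma>: "path_image \<gamma> = L" "finite S"
      "\<And>t. t \<in> {0..1} - S \<Longrightarrow> vector_derivative \<gamma> (at t) \<noteq> 0"
    using assms by (auto simp: piecewise_smooth_curve_def)
  have "infinite ({0<..<1::real} - S)"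
    using \<gamma>(2) by (simp add: Diff_infinite_finite)
  then obtain t where t: "t \<in> {0<..<1}" "t \<notin> S"
    by (metis DiffE ex_in_conv finite.emptyI)
  have "(\<gamma> has_vector_derivative 0) (at t)"
  proof (rule has_vector_derivative_transform_within_open)
    show "((\<lambda>_. z) has_vector_derivative 0) (at t)" by (rule has_vector_derivative_const)
    show "z = \<gamma> s" if "s \<in> {0<..<1}" for s
      using that const \<gamma>(1) by (auto simp: path_image_def)
  qed (use t in auto)
  then have "vector_derivative \<gamma> (at t) = 0" by (rule vector_derivative_at)
  with \<gamma>(3)[of t] t show False by auto
qed

section \<open>Circles on a sphere\<close>

unbundle cross3_syntax

text \<open>Some axis is not parallel to \<open>e\<close>; normalizing its cross product with
  \<open>e\<close> gives \<open>f\<close>. The expansion follows from Lagrange's identity: v = e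
  \<times> (v \<times> e) for v orthogonal to e, where the inner e is rewritten as f \<times> (e
  \<times> f).\<close>

lemma orthonormal_frame_real3:
  fixes e :: "real ^ 3"
  assumes "norm e = 1"
  obtains f where "norm f = 1" "e \<bullet> f = 0" "norm (e \<times> f) = 1" "f \<bullet> (e \<times> f) = 0" "e \<bullet> (e \<times> f) = 0"
    "\<forall>v. e \<bullet> v = 0 \<longrightarrow> v = (v \<bullet> f) *\<^sub>R f + (v \<bullet> (e \<times> f)) *\<^sub>R (e \<times> f)"
proof -
  have "e \<noteq> 0" using assms by auto
  then obtain b where "e \<times> b \<noteq> 0" using cross_basis_nonzero by blast
  define f where "f = sgn (e \<times> b)"
  have f: "norm f = 1" "e \<bullet> f = 0"
    using \<open>e \<times> b \<noteq> 0\<close> by (simp_all add: f_def norm_sgn sgn_div_norm dot_cross_self)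
  have "norm (e \<times> f) = 1"
    by (rule power2_eq_imp_eq) (use norm_cross_dot[of e f] f assms in simp_all)
  moreover have "v = (v \<bullet> f) *\<^sub>R f + (v \<bullet> (e \<times> f)) *\<^sub>R (e \<times> f)" if "e \<bullet> v = 0" for v
  proof -
    have ff: "f \<bullet> f = 1" "e \<bullet> e = 1" using f assms by (simp_all add: dot_square_norm)
    have e: "f \<times> (e \<times> f) = e"
      using f ff by (simp add: Lagrange inner_commute)
    have f': "e \<times> (e \<times> f) = - f"
      using f ff by (simp add: Lagrange)
    have "v = e \<times> (v \<times> e)"
      using that ff by (simp add: Lagrange)
    also have "v \<times> e = (v \<bullet> (e \<times> f)) *\<^sub>R f - (v \<bullet> f) *\<^sub>R (e \<times> f)"
      using Lagrange[of v f "e \<times> f"] e by simp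
    also have "e \<times> \<dots> = (v \<bullet> f) *\<^sub>R f + (v \<bullet> (e \<times> f)) *\<^sub>R (e \<times> f)"
      by (simp add: Cross3.right_diff_distrib cross_mult_right f')
    finally show ?thesis .
  qed
  ultimately show thesis
    using f by (intro that[of f]) (auto simp: dot_cross_self)
qed

lemma abs_sin_diff_le: "\<bar>sin s - sin t\<bar> \<le> \<bar>s - t\<bar>" for s t :: real
proof -
  have "\<bar>sin ((s - t) / 2)\<bar> * \<bar>cos ((s + t) / 2)\<bar> \<le> \<bar>(s - t) / 2\<bar> * 1"
    by (intro mult_mono abs_sin_x_le_abs_x) auto
  then show ?thesis
    unfolding sin_diff_sin abs_mult by simp
qed

lemma abs_cos_diff_le: "\<bar>cos s - cos t\<bar> \<le> \<bar>s - t\<bar>" for s t :: real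
proof -
  have "\<bar>sin ((s + t) / 2)\<bar> * \<bar>sin ((t - s) / 2)\<bar> \<le> 1 * \<bar>(t - s) / 2\<bar>"
    by (intro mult_mono abs_sin_x_le_abs_x) auto
  then show ?thesis
    unfolding cos_diff_cos abs_mult by simp
qed

text \<open>The lower bound is the diameter of the circle, seen by projecting to the axis
  \<open>f\<close>. The upper bound comes from the angular parametrization with the crude Lipschitz
  constant 2 \<rho>, one \<rho> for each of cosine and sine.\<close>

lemma hausdorff1_circle:
  fixes a e :: "real ^ 3"
  assumes "norm e = 1" "\<bar>s\<bar> \<le> R"
  defines "Z \<equiv> {x \<in> sphere a R. (x - a) \<bullet> e = s}"
  shows "ennreal (2 * sqrt (R\<^sup>2 - s\<^sup>2)) \<le> hausdorff1 Z"
    and "hausdorff1 Z \<le> ennreal (4 * pi * sqrt (R\<^sup>2 - s\<^sup>2))"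
proof -
  obtain f where f: "norm f = 1" "e \<bullet> f = 0" "norm (e \<times> f) = 1" "f \<bullet> (e \<times> f) = 0" "e \<bullet> (e \<times> f) = 0"
    and expand: "\<forall>v. e \<bullet> v = 0 \<longrightarrow> v = (v \<bullet> f) *\<^sub>R f + (v \<bullet> (e \<times> f)) *\<^sub>R (e \<times> f)"
    by (rule orthonormal_frame_real3[OF assms(1)])
  define g where "g = e \<times> f"
  note f = f[folded g_def] note expand = expand[folded g_def, rule_format]
  have inner_self: "e \<bullet> e = 1" "f \<bullet> f = 1" "g \<bullet> g = 1"
    using assms(1) f by (simp_all add: dot_square_norm)
  have "f \<bullet> e = 0" "g \<bullet> f = 0" "g \<bullet> e = 0"
    using f by (simp_all add: inner_commute)
  note inners = f(2,4,5) this inner_self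
  have "0 \<le> R" using assms(2) by simp
  define \<rho> where "\<rho> = sqrt (R\<^sup>2 - s\<^sup>2)"
  have \<rho>: "0 \<le> \<rho>" "\<rho>\<^sup>2 = R\<^sup>2 - s\<^sup>2"
    using assms(2) abs_le_square_iff[of s R] by (simp_all add: \<rho>_def)
  have Z_I: "a + s *\<^sub>R e + u *\<^sub>R f + v *\<^sub>R g \<in> Z" if "u\<^sup>2 + v\<^sup>2 = \<rho>\<^sup>2" for u v
  proof -
    define w where "w = s *\<^sub>R e + u *\<^sub>R f + v *\<^sub>R g"
    have "w \<bullet> w = R\<^sup>2"
      using that \<rho> by (simp add: w_def inner_add_left inner_add_right inners power2_eq_square)
    then have "norm w = R"
      using \<open>0 \<le> R\<close> by (simp add: norm_eq_sqrt_inner)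
    moreover have "w \<bullet> e = s"
      by (simp add: w_def inner_add_left inners)
    ultimately have "a + w \<in> Z" by (simp add: Z_def dist_norm)
    then show ?thesis by (simp add: w_def add.assoc)
  qed
  show "ennreal (2 * sqrt (R\<^sup>2 - s\<^sup>2)) \<le> hausdorff1 Z"
  proof -
    have "ennreal (\<rho> - (- \<rho>)) \<le> hausdorff1 Z"
    proof (rule hausdorff1_ge_interval)
      show "1-lipschitz_on Z (\<lambda>x. (x - a) \<bullet> f)"
      proof (rule lipschitz_onI)
        fix x y
        have "dist ((x - a) \<bullet> f) ((y - a) \<bullet> f) = \<bar>(x - y) \<bullet> f\<bar>"
          by (simp add: dist_real_def inner_diff_left)
        then show "dist ((x - a) \<bullet> f) ((y - a) \<bullet> f) \<le> 1 * dist x y"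
          using Cauchy_Schwarz_ineq2[of "x - y" f] f(1) by (simp add: dist_norm)
      qed simp
      show "{- \<rho><..<\<rho>} \<subseteq> (\<lambda>x. (x - a) \<bullet> f) ` Z"
      proof
        fix u assume "u \<in> {- \<rho><..<\<rho>}"
        then have "u\<^sup>2 \<le> \<rho>\<^sup>2" using abs_le_square_iff[of u \<rho>] by auto
        then have "u\<^sup>2 + (sqrt (\<rho>\<^sup>2 - u\<^sup>2))\<^sup>2 = \<rho>\<^sup>2" by simp
        from Z_I[OF this] show "u \<in> (\<lambda>x. (x - a) \<bullet> f) ` Z"
          by (rule rev_image_eqI) (simp add: inner_add_left inners)
      qed
    qed
    then show ?thesis by (simp add: \<rho>_def)
  qed
  define \<kappa> where "\<kappa> t = a + s *\<^sub>R e + (\<rho> * cos t) *\<^sub>R f + (\<rho> * sin t) *\<^sub>R g" for t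
  have "hausdorff1 Z \<le> ennreal (2 * \<rho> * (2 * pi - 0))"
  proof (rule hausdorff1_lipschitz_image_le)
    show "(2 * \<rho>)-lipschitz_on {0..2 * pi} \<kappa>"
    proof (rule lipschitz_onI)
      fix t t' :: real
      have "\<kappa> t - \<kappa> t' = (\<rho> * (cos t - cos t')) *\<^sub>R f + (\<rho> * (sin t - sin t')) *\<^sub>R g"
        by (simp add: \<kappa>_def algebra_simps)
      then have "dist (\<kappa> t) (\<kappa> t') \<le> \<rho> * \<bar>cos t - cos t'\<bar> + \<rho> * \<bar>sin t - sin t'\<bar>"
        using norm_triangle_ineq[of "(\<rho> * (cos t - cos t')) *\<^sub>R f" "(\<rho> * (sin t - sin t')) *\<^sub>R g"] f(1,3) \<rho>(1)
        by (simp add: dist_norm abs_mult)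
      also have "\<dots> \<le> \<rho> * \<bar>t - t'\<bar> + \<rho> * \<bar>t - t'\<bar>"
        using \<rho>(1) by (intro add_mono mult_left_mono abs_cos_diff_le abs_sin_diff_le)
      finally show "dist (\<kappa> t) (\<kappa> t') \<le> 2 * \<rho> * dist t t'"
        by (simp add: dist_real_def)
    qed (use \<rho>(1) in simp)
    show "Z \<subseteq> \<kappa> ` {0..2 * pi}"
    proof
      fix x assume x: "x \<in> Z"
      define v where "v = x - a - s *\<^sub>R e"
      have xa: "(x - a) \<bullet> e = s" "(x - a) \<bullet> (x - a) = R\<^sup>2"
        using x by (auto simp: Z_def dist_norm norm_minus_commute dot_square_norm)
      then have ev: "e \<bullet> v = 0" "v \<bullet> v = \<rho>\<^sup>2"
        using \<rho> inner_self by (simp_all add: v_def inner_diff_left inner_diff_right inner_commute power2_eq_square)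
      define p q where "p = v \<bullet> f" and "q = v \<bullet> g"
      have v: "v = p *\<^sub>R f + q *\<^sub>R g" using expand[OF ev(1)] by (simp add: p_def q_def)
      have "p\<^sup>2 + q\<^sup>2 = \<rho>\<^sup>2"
        using ev(2) unfolding v by (simp add: inner_add_left inner_add_right inners power2_eq_square)
      \<comment> \<open>For \<rho> = 0 the circle is a single point and any angle will do.\<close>
      obtain t where t: "t \<in> {0..2 * pi}" "p = \<rho> * cos t" "q = \<rho> * sin t"
      proof (cases "\<rho> = 0")
        case True
        then show ?thesis using \<open>p\<^sup>2 + q\<^sup>2 = \<rho>\<^sup>2\<close> that[of 0] by (simp add: sum_power2_eq_zero_iff)
      next
        case False
        then have "(p / \<rho>)\<^sup>2 + (q / \<rho>)\<^sup>2 = 1"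
          using \<open>p\<^sup>2 + q\<^sup>2 = \<rho>\<^sup>2\<close> by (simp add: power_divide flip: add_divide_distrib)
        then obtain t where "0 \<le> t" "t < 2 * pi" "p / \<rho> = cos t" "q / \<rho> = sin t"
          by (rule sincos_total_2pi)
        then show ?thesis using False by (intro that[of t]) (auto simp: field_simps)
      qed
      have "x = a + s *\<^sub>R e + v" by (simp add: v_def)
      also have "\<dots> = \<kappa> t" unfolding v t(2,3) \<kappa>_def by (simp add: add.assoc)
      finally show "x \<in> \<kappa> ` {0..2 * pi}" using t(1) by blast
    qed
  qed simp
  then show "hausdorff1 Z \<le> ennreal (4 * pi * sqrt (R\<^sup>2 - s\<^sup>2))"
    by (simp add: \<rho>_def mult_ac)
qed

unbundle no cross3_syntax

section \<open>Gradients of distances and of travel time differences\<close>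

lemma gradient_eqI:
  assumes "GDERIV h x :> D"
  shows "gradient h x = D"
  unfolding gradient_def
proof (rule the_equality)
  show "GDERIV h x :> D" by (rule assms)
  fix D' assume "GDERIV h x :> D'"
  with assms have "(\<lambda>v. v \<bullet> D') = (\<lambda>v. v \<bullet> D)"
    by (auto simp: gderiv_def intro: has_derivative_unique)
  \<comment> \<open>Evaluating both derivatives in the direction \<open>D' - D\<close> forces its
    norm to be 0.\<close>
  then have "(D' - D) \<bullet> D' = (D' - D) \<bullet> D" by metis
  then have "(D' - D) \<bullet> (D' - D) = 0"
    using inner_diff_right[of "D' - D" D' D] by simp
  then show "D' = D" by simp
qed

lemma GDERIV_dist:
  fixes x y :: "'a::real_inner"
  assumes "x \<noteq> y"
  shows "GDERIV (\<lambda>x. dist x y) x :> sgn (x - y)"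
proof -
  have "((\<lambda>x. norm (x - y)) has_derivative (\<lambda>v. v \<bullet> sgn (x - y))) (at x)"
    using assms by (auto intro!: has_derivative_compose[where f="\<lambda>x. x - y", OF _ has_derivative_norm]
        derivative_eq_intros)
  then show ?thesis by (simp add: gderiv_def dist_norm)
qed

text \<open>As both distances equal r, the difference of the unit vectors collapses to (z - y) / r,
  so the full gradient is \<open>k *\<^sub>R e\<close>. Removing its normal component, where e has
  component s / R, leaves the factor sqrt (1 - (s / R)^2).\<close>

lemma norm_tangential_gradient_travel_time_difference:
  fixes a x y z :: "'a::real_inner"
  assumes "0 < c" "dist x a = R" "0 < R" "y \<noteq> z" "x \<noteq> y" "dist x y = dist x z"
    and s: "(x - a) \<bullet> sgn (z - y) = s"
  shows "norm (tangential_gradient a (\<lambda>x. dist x y / c - dist x z / c) x)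
    = dist y z * sqrt (R\<^sup>2 - s\<^sup>2) / (c * dist x y * R)"
proof -
  define r where "r = dist x y"
  define k where "k = dist y z / (c * r)"
  define e where "e = sgn (z - y)"
  define n where "n = sgn (x - a)"
  have "x \<noteq> z" using assms(5,6) by auto
  have r: "0 < r" "norm (x - y) = r" "norm (x - z) = r"
    using assms by (auto simp: r_def dist_norm)
  have k: "0 \<le> k" using r(1) \<open>0 < c\<close> by (simp add: k_def)
  have e: "norm e = 1" and n: "norm n = 1" "n = (1 / R) *\<^sub>R (x - a)"
    using assms by (auto simp: e_def n_def norm_sgn sgn_div_norm dist_norm divide_inverse)
  have en: "e \<bullet> n = s / R"
    using s n(2) by (simp add: e_def inner_commute)
  have "GDERIV (\<lambda>x. (1 / c) * dist x y - (1 / c) * dist x z) x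
      :> ((1 / c) *\<^sub>R sgn (x - y) + dist x y *\<^sub>R 0) - ((1 / c) *\<^sub>R sgn (x - z) + dist x z *\<^sub>R 0)"
    using \<open>x \<noteq> y\<close> \<open>x \<noteq> z\<close> by (intro GDERIV_diff GDERIV_mult GDERIV_const GDERIV_dist)
  then have "gradient (\<lambda>x. dist x y / c - dist x z / c) x = (1 / c) *\<^sub>R sgn (x - y) - (1 / c) *\<^sub>R sgn (x - z)"
    by (intro gradient_eqI) simp
  also have "\<dots> = (1 / (c * r)) *\<^sub>R (z - y)"
    using r by (simp add: sgn_div_norm algebra_simps divide_inverse)
  also have "\<dots> = k *\<^sub>R e"
    using \<open>y \<noteq> z\<close> by (simp add: k_def e_def sgn_div_norm dist_norm norm_minus_commute)
  finally have tg: "tangential_gradient a (\<lambda>x. dist x y / c - dist x z / c) x = k *\<^sub>R (e - (e \<bullet> n) *\<^sub>R n)"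
    by (simp add: tangential_gradient_def n_def scaleR_diff_right)
  have "(norm (e - (e \<bullet> n) *\<^sub>R n))\<^sup>2 = 1 - (s / R)\<^sup>2"
    unfolding power2_norm_eq_inner using e n(1) en inner_commute[of n e]
    by (simp add: inner_diff_left inner_diff_right norm_eq_1 power2_eq_square)
  also have "\<dots> = (R\<^sup>2 - s\<^sup>2) / R\<^sup>2"
    using \<open>0 < R\<close> by (simp add: power_divide diff_divide_distrib)
  finally have "norm (e - (e \<bullet> n) *\<^sub>R n) = sqrt ((R\<^sup>2 - s\<^sup>2) / R\<^sup>2)"
    by (metis norm_ge_zero real_sqrt_unique)
  also have "\<dots> = sqrt (R\<^sup>2 - s\<^sup>2) / R"
    using \<open>0 < R\<close> by (simp add: real_sqrt_divide)
  finally show ?thesis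
    unfolding tg using k r(1) \<open>0 < c\<close> by (simp add: k_def r_def abs_mult)
qed

section \<open>The indicator function\<close>

text \<open>The squared distances differ by an affine function of \<open>x\<close> that vanishes at
  the midpoint and has normal direction \<open>z - y\<close>. For \<open>y = z\<close> both sides
  are true, as \<open>sgn 0 = 0\<close>.\<close>

lemma dist_eq_iff_inner_sgn:
  fixes a x y z :: "'a::real_inner"
  shows "dist x y = dist x z \<longleftrightarrow> (x - a) \<bullet> sgn (z - y) = (midpoint y z - a) \<bullet> sgn (z - y)"
proof (cases "y = z")
  case False
  have "(dist x y)\<^sup>2 - (dist x z)\<^sup>2 = 2 * ((x - midpoint y z) \<bullet> (z - y))"
    by (simp add: dist_norm power2_norm_eq_inner midpoint_def inner_diff_left inner_diff_right
        inner_add_left inner_add_right inner_commute field_simps)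
  then have "dist x y = dist x z \<longleftrightarrow> (x - midpoint y z) \<bullet> (z - y) = 0"
    using power2_eq_iff_nonneg[of "dist x y" "dist x z"] by auto
  also have "\<dots> \<longleftrightarrow> (x - midpoint y z) \<bullet> sgn (z - y) = 0"
    using False by (simp add: sgn_div_norm)
  also have "\<dots> \<longleftrightarrow> (x - a) \<bullet> sgn (z - y) = (midpoint y z - a) \<bullet> sgn (z - y)"
    by (simp add: inner_diff_left)
  finally show ?thesis .
qed simp

text \<open>On the circle the integrand depends only on \<open>dist x y\<close> and decreases in it,
  and this distance lies between \<open>R - dist a y\<close> and \<open>2 * R\<close>. Each bound is
  an extreme value times a bound for the length of the circle. \<open>T\<close> stands for the
  intensity at \<open>y\<close>.\<close>

lemma sphere_delta_integral_bounds:
  fixes a y z :: point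
  assumes y: "y \<in> ball a R" and z: "z \<in> ball a R" and "y \<noteq> z" "0 < c" "0 \<le> T"
  defines "I \<equiv> sphere_delta_integral a R
      (\<lambda>x. T * (1 / (4 * pi * dist x y)) * (1 / (4 * pi * dist x z))) (\<lambda>x. dist x y / c - dist x z / c)"
  shows "ennreal (T * c / (16 * pi\<^sup>2 * dist y z)) \<le> I"
    and "I \<le> ennreal (T * c * R / (4 * pi * (R - dist a y) * dist y z))"
proof -
  define e where "e = sgn (z - y)"
  define s where "s = (midpoint y z - a) \<bullet> e"
  define Z where "Z = {x \<in> sphere a R. (x - a) \<bullet> e = s}"
  define \<rho> where "\<rho> = sqrt (R\<^sup>2 - s\<^sup>2)"
  define d where "d = dist y z"
  define F where "F x = T * (1 / (4 * pi * dist x y)) * (1 / (4 * pi * dist x z)) /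
      norm (tangential_gradient a (\<lambda>x. dist x y / c - dist x z / c) x)" for x
  \<comment> \<open>The integrand at distance r: the two Green's functions give 1 / (4 pi r) each,
    and the division by the tangential gradient multiplies by c r R / (d \<rho>), which removes one
    r.\<close>
  define K where "K r = T * c * R / (16 * pi\<^sup>2 * r * d * \<rho>)" for r
  have "0 < R" using y by (metis centre_in_ball empty_iff ball_eq_empty not_le)
  have "0 < d" using \<open>y \<noteq> z\<close> by (simp add: d_def)
  have e: "norm e = 1" using \<open>y \<noteq> z\<close> by (simp add: e_def norm_sgn)
  \<comment> \<open>By convexity the bisecting plane passes through the open ball, so it cuts the
    sphere in a circle of positive radius.\<close>
  have "midpoint y z \<in> ball a R"
    using closed_segment_subset[OF y z convex_ball] midpoint_in_closed_segment by blast
  then have "\<bar>s\<bar> < R"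
    using Cauchy_Schwarz_ineq2[of "midpoint y z - a" e] e by (simp add: s_def dist_norm norm_minus_commute)
  then have "s\<^sup>2 < R\<^sup>2"
    using power_strict_mono[of "\<bar>s\<bar>" R 2] by simp
  then have "0 < \<rho>" by (simp add: \<rho>_def)
  have zero_set: "{x \<in> sphere a R. dist x y / c - dist x z / c = 0} = Z"
    using dist_eq_iff_inner_sgn[of _ y z a] \<open>0 < c\<close> by (auto simp: Z_def e_def s_def)
  have on_Z: "F x = K (dist x y)" "R - dist a y \<le> dist x y" "dist x y \<le> 2 * R" "0 < dist x y" if "x \<in> Z" for x
  proof -
    have x: "dist x a = R" "dist x y = dist x z" "(x - a) \<bullet> sgn (z - y) = s"
      using that dist_eq_iff_inner_sgn[of x y z a] by (auto simp: Z_def e_def s_def dist_commute)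
    show "R - dist a y \<le> dist x y" "dist x y \<le> 2 * R"
      using x(1) y dist_triangle[of x a y] dist_triangle[of x y a] by (auto simp: dist_commute)
    then show "0 < dist x y" using y by auto
    then have "x \<noteq> y" by auto
    have "F x = T * (1 / (4 * pi * dist x y)) * (1 / (4 * pi * dist x y)) / (d * \<rho> / (c * dist x y * R))"
      unfolding F_def d_def \<rho>_def
      by (subst norm_tangential_gradient_travel_time_difference[OF \<open>0 < c\<close> x(1) \<open>0 < R\<close> \<open>y \<noteq> z\<close> \<open>x \<noteq> y\<close> x(2,3)])
        (simp add: x(2))
    also have "\<dots> = K (dist x y)"
      using \<open>0 < dist x y\<close> by (simp add: K_def power2_eq_square)
    finally show "F x = K (dist x y)" .
  qed
  have K_antimono: "K r' \<le> K r" if "0 < r" "r \<le> r'" for r r'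
    unfolding K_def using that \<open>0 \<le> T\<close> \<open>0 < c\<close> \<open>0 < R\<close> \<open>0 < d\<close> \<open>0 < \<rho>\<close>
    by (intro divide_left_mono mult_right_mono mult_left_mono mult_pos_pos mult_nonneg_nonneg) auto
  have K_nonneg: "0 \<le> K r" if "0 < r" for r
    unfolding K_def using that \<open>0 \<le> T\<close> \<open>0 < c\<close> \<open>0 < R\<close> \<open>0 < d\<close> \<open>0 < \<rho>\<close> by simp
  have I: "I = (\<integral>\<^sup>+x. ennreal (F x) * indicator Z x \<partial>arclength)"
    unfolding I_def sphere_delta_integral_def zero_set F_def ..
  have "closed Z"
    unfolding Z_def sphere_def mem_Collect_eq
    by (intro closed_Collect_conj closed_Collect_eq continuous_intros)
  then have Z_sets: "Z \<in> sets borel" by (rule borel_closed)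
  have H: "ennreal (2 * \<rho>) \<le> hausdorff1 Z" "hausdorff1 Z \<le> ennreal (4 * pi * \<rho>)"
    unfolding Z_def \<rho>_def using hausdorff1_circle[OF e, of s R a] \<open>\<bar>s\<bar> < R\<close> by simp_all
  have const: "(\<integral>\<^sup>+x. ennreal k * indicator Z x \<partial>arclength) = ennreal k * hausdorff1 Z" for k
    using Z_sets by (simp add: nn_integral_cmult_indicator emeasure_arclength)
  \<comment> \<open>With the greatest distance \<open>2 * R\<close> and the length bound 2 \<rho>,
    both R and \<rho> cancel.\<close>
  have "T * c / (16 * pi\<^sup>2 * dist y z) = K (2 * R) * (2 * \<rho>)"
    using \<open>0 < R\<close> \<open>0 < \<rho>\<close> by (simp add: K_def d_def)
  also have "ennreal \<dots> = ennreal (K (2 * R)) * ennreal (2 * \<rho>)"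
    using K_nonneg[of "2 * R"] \<open>0 < R\<close> by (intro ennreal_mult') simp
  also have "\<dots> \<le> ennreal (K (2 * R)) * hausdorff1 Z"
    using H(1) by (rule mult_left_mono) simp
  also have "\<dots> \<le> I"
    unfolding I const[symmetric] using on_Z
    by (intro nn_integral_mono) (auto simp: indicator_def intro!: ennreal_leI K_antimono)
  finally show "ennreal (T * c / (16 * pi\<^sup>2 * dist y z)) \<le> I" .
  have \<delta>: "0 < R - dist a y" using y by simp
  have cancel: "p / (q * r) * r = p / q" if "r \<noteq> 0" for p q r :: real
    using that by simp
  have "K (R - dist a y) = T * c * R / (4 * pi * (R - dist a y) * dist y z * (4 * pi * \<rho>))"
    unfolding K_def d_def by (rule arg_cong[where f="(/) _"]) (simp add: power2_eq_square)
  then have K_eq: "K (R - dist a y) * (4 * pi * \<rho>) = T * c * R / (4 * pi * (R - dist a y) * dist y z)"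
    by (rule ssubst) (rule cancel, use \<open>0 < \<rho>\<close> in simp)
  have "I \<le> ennreal (K (R - dist a y)) * hausdorff1 Z"
    unfolding I const[symmetric] using on_Z \<delta>
    by (intro nn_integral_mono) (auto simp: indicator_def intro!: ennreal_leI K_antimono)
  also have "\<dots> \<le> ennreal (K (R - dist a y)) * ennreal (4 * pi * \<rho>)"
    using H(2) by (rule mult_left_mono) simp
  also have "\<dots> = ennreal (K (R - dist a y) * (4 * pi * \<rho>))"
    using K_nonneg[OF \<delta>] \<open>0 < \<rho>\<close> by (intro ennreal_mult'[symmetric]) simp
  also have "\<dots> = ennreal (T * c * R / (4 * pi * (R - dist a y) * dist y z))"
    by (simp only: K_eq)
  finally show "I \<le> ennreal (T * c * R / (4 * pi * (R - dist a y) * dist y z))" .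
qed

theorem theorem3p6:
  fixes c R \<tau>\<^sub>0 :: real and a :: point and L D :: "point set"
    and \<tau> :: "point \<Rightarrow> real" and u :: field
  assumes "c > 0"
    and "piecewise_smooth_curve L" and "emeasure arclength L < \<infinity>"
    and "\<tau> \<in> borel_measurable (restrict_space borel L)" and "bounded (\<tau> ` L)"
    and "\<tau>\<^sub>0 > 0" and "\<And>x. x \<in> L \<Longrightarrow> \<tau> x \<ge> \<tau>\<^sub>0"
    and "wave_equation c L \<tau> dirac_signal u" and "causal L u"
    and "u = retarded_field c \<tau> dirac_signal"
    and "R > 0" and "L \<subseteq> ball a R"
    and "D \<subseteq> ball a R" and "L \<subseteq> D" and "D \<inter> sphere a R = {}"
  shows "(\<forall>z \<in> L. imaging_indicator c a R L dirac_signal u z = \<infinity>) \<and>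
         (\<forall>z \<in> D - L. imaging_indicator c a R L dirac_signal u z < \<infinity>)"
proof (intro conjI ballI)
  \<comment> \<open>The inner integral after convolution with the unit pulse at time 0, which
    changes neither weight nor arrival time.\<close>
  define J where "J z y = sphere_delta_integral a R
      (\<lambda>x. \<tau> y * (1 / (4 * pi * dist x y)) * (1 / (4 * pi * dist x z)))
      (\<lambda>x. dist x y / c - dist x z / c)" for z y
  have ind: "imaging_indicator c a R L dirac_signal u z = (\<integral>\<^sup>+y\<in>L. J z y \<partial>arclength)" for z
    by (simp add: imaging_indicator_def J_def assms(10) retarded_field_def scale_pulse_def
        convolve_def green_def dirac_signal_def)
  have L: "compact L" "connected L"
    using assms(2) by (rule piecewise_smooth_curve_compact, rule piecewise_smooth_curve_connected)
  have \<tau>: "0 \<le> \<tau> y" "\<tau>\<^sub>0 \<le> \<tau> y" if "y \<in> L" for y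
    using assms(6,7) that by (auto intro: order_trans[of 0 \<tau>\<^sub>0])
  show "imaging_indicator c a R L dirac_signal u z = \<infinity>" if "z \<in> L" for z
  proof -
    obtain w where w: "w \<in> L" "w \<noteq> z"
      using piecewise_smooth_curve_not_singleton[OF assms(2)] by blast
    show ?thesis
      unfolding ind
    proof (rule nn_integral_inverse_dist_connected[OF L(2) compact_imp_closed[OF L(1)] \<open>z \<in> L\<close> w])
      show "0 < \<tau>\<^sub>0 * c / (16 * pi\<^sup>2)" using assms(1,6) by simp
      fix y assume y: "y \<in> L" "y \<noteq> z"
      have "ennreal (\<tau>\<^sub>0 * c / (16 * pi\<^sup>2) / dist y z) \<le> ennreal (\<tau> y * c / (16 * pi\<^sup>2 * dist y z))"
        using \<tau>(2)[OF y(1)] assms(1) by (intro ennreal_leI) (simp add: divide_right_mono mult_right_mono)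
      also have "\<dots> \<le> J z y"
        unfolding J_def using y \<open>z \<in> L\<close> assms(1,12) \<tau>(1)
        by (intro sphere_delta_integral_bounds(1)) auto
      finally show "ennreal (\<tau>\<^sub>0 * c / (16 * pi\<^sup>2) / dist y z) \<le> J z y" .
    qed
  qed
  fix z assume z: "z \<in> D - L"
  obtain T where T: "\<And>y. y \<in> L \<Longrightarrow> \<tau> y \<le> T"
    using assms(5) by (auto simp: bounded_real intro: order_trans[OF abs_ge_self])
  have "L \<noteq> {}"
    using piecewise_smooth_curve_not_singleton[OF assms(2)] by blast
  \<comment> \<open>Compactness makes the bound uniform in \<open>y\<close>: the point of
    \<open>L\<close> farthest from the centre fixes a positive gap to the sphere, and the point
    nearest to \<open>z\<close> a positive distance from \<open>z\<close>.\<close>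
  then obtain y\<^sub>0 where y\<^sub>0: "y\<^sub>0 \<in> L" "\<And>y. y \<in> L \<Longrightarrow> dist a y \<le> dist a y\<^sub>0"
    using distance_attains_sup[OF L(1)] by blast
  obtain y\<^sub>1 where y\<^sub>1: "y\<^sub>1 \<in> L" "\<And>y. y \<in> L \<Longrightarrow> dist z y\<^sub>1 \<le> dist z y"
    using distance_attains_inf[OF compact_imp_closed[OF L(1)] \<open>L \<noteq> {}\<close>] by blast
  define K where "K = T * c * R / (4 * pi * (R - dist a y\<^sub>0) * dist y\<^sub>1 z)"
  have pos: "0 < R - dist a y\<^sub>0" "0 < dist y\<^sub>1 z"
    using y\<^sub>0(1) y\<^sub>1(1) assms(12) z by auto
  have J_le: "J z y \<le> ennreal K" if "y \<in> L" for y
  proof -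
    have "J z y \<le> ennreal (\<tau> y * c * R / (4 * pi * (R - dist a y) * dist y z))"
      unfolding J_def using that z assms(1,12,13) \<tau>(1)
      by (intro sphere_delta_integral_bounds(2)) auto
    also have "\<dots> \<le> ennreal K"
      unfolding K_def using T[OF that] \<tau>(1)[OF that] pos y\<^sub>0(2)[OF that] y\<^sub>1(2)[OF that] assms(1,11)
      by (intro ennreal_leI frac_le mult_mono mult_right_mono mult_pos_pos mult_nonneg_nonneg)
        (auto simp: dist_commute)
    finally show ?thesis .
  qed
  \<comment> \<open>A constant bound on the kernel over a set of finite length.\<close>
  have "imaging_indicator c a R L dirac_signal u z \<le> (\<integral>\<^sup>+y. ennreal K * indicator L y \<partial>arclength)"
    unfolding ind using J_le by (intro nn_integral_mono) (auto simp: indicator_def)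
  also have "\<dots> = ennreal K * emeasure arclength L"
    using L(1) by (simp add: nn_integral_cmult_indicator borel_compact)
  also have "\<dots> < \<infinity>"
    using assms(3) by (simp add: ennreal_mult_less_top)
  finally show "imaging_indicator c a R L dirac_signal u z < \<infinity>" .
qed

end
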